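(* Let $h\in\mathbb{Z}[X]$ and let $(a_n)_{n\in\mathbb{N}}$ be the sequence of $h$-Schenker sums, $a_n=\sum_{j=0}^n\frac{n!}{j!}h(n)^j$. Let $d=p_1^{k_1}\cdots p_s^{k_s}$ be (the prime factorization of) a positive integer, and let $n_0$ be the smallest positive integer such that $p_i^{k_i}\mid n_0!$ for each $i\in\{1,2,\dots,s\}$. Then the sequence of remainders $(a_n\bmod d)_{n\ge n_0}$ is periodic of period $\operatorname{lcm}\{p_i^{k_i}(p_i-1): i\in\{1,2,\dots,s\}\}$.
   Context: $\mathbb{N}=\{0,1,2,\dots\}$ and $0^0=1$. "Periodic of period $T$" means that the $n$-th and $(n+T)$-th terms agree for all $n\ge n_0$; $T$ need not be the least period. *)

theory Defs
  imports Complex_Main "HOL-Computational_Algebra.Computational_Algebra"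
begin

text \<open>The quotient of factorials is an exact integer division, as \<open>j \<le> n\<close>.\<close>

definition schenker_sum :: "int poly \<Rightarrow> nat \<Rightarrow> int" where
  "schenker_sum h n = (\<Sum>j=0..n. (fact n div fact j) * poly h (int n) ^ j)"

text \<open>Positivity of \<open>T\<close> is required, since every sequence would satisfy the equation for
  \<open>T = 0\<close>. The period need not be the least one.\<close>

definition periodic_from :: "nat \<Rightarrow> nat \<Rightarrow> (nat \<Rightarrow> 'a) \<Rightarrow> bool" where
  "periodic_from n0 T f \<longleftrightarrow> 0 < T \<and> (\<forall>n\<ge>n0. f (n + T) = f n)"

end

theory Submission
  imports Defs "HOL-Number_Theory.Residues"
begin

text \<open>
  It suffices to work modulo a prime power \<open>q = p ^ k\<close> dividing \<open>n0!\<close>, where the shift \<open>T\<close> is a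
  multiple of \<open>p ^ k * (p - 1)\<close>. Write \<open>x = h(n)\<close>; then \<open>h(n + T)\<close> agrees with \<open>x\<close> modulo \<open>q\<close>.
  If \<open>p\<close> divides \<open>x\<close>, then every summand \<open>n! x ^ j / j!\<close> is divisible by \<open>q\<close>, because the
  \<open>p\<close>-adic valuation of \<open>j!\<close> is at most \<open>j\<close>. Otherwise, reversing the sum turns the summands into
  \<open>n (n - 1) \<dots> (n - i + 1) x ^ (n - i)\<close>. These vanish modulo \<open>q\<close> for \<open>i \<ge> n0\<close>, as
  \<open>i!\<close> divides the falling factorial, and for fixed \<open>i < n0\<close> they are periodic by Euler's theorem.
\<close>

text \<open>Legendre's recursion: only multiples of \<open>p\<close> contribute, and
  \<open>p * i\<close> contributes one more than \<open>i\<close>. In the induction, both sides thus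
  change only when \<open>p\<close> divides \<open>Suc j\<close>, and then by the same
  amount.\<close>

lemma multiplicity_fact_rec:
  fixes p :: nat
  assumes "prime p"
  shows "multiplicity p (fact j :: nat) = j div p + multiplicity p (fact (j div p) :: nat)"
proof (induction j)
  case 0
  then show ?case by simp
next
  case (Suc j)
  have p: "prime_elem p" "0 < p" "p > 1" using assms by (auto simp: prime_gt_0_nat prime_gt_Suc_0_nat)
  have step: "multiplicity p (fact (Suc i) :: nat)
      = multiplicity p (Suc i) + multiplicity p (fact i :: nat)" for i
    unfolding fact_Suc of_nat_id
    by (rule prime_elem_multiplicity_mult_distrib[OF p(1)]) auto
  show ?case
  proof (cases "p dvd Suc j")
    case True
    then have d: "Suc j div p = Suc (j div p)" by (simp add: div_Suc dvd_eq_mod_eq_0)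
    have "Suc j = p * Suc (j div p)" using True d by (metis dvd_mult_div_cancel)
    then have "multiplicity p (Suc j) = Suc (multiplicity p (Suc (j div p)))"
      using p by (metis multiplicity_times_same nat.distinct(1) not_prime_unit assms
          less_numeral_extra(3))
    then show ?thesis using Suc.IH by (simp only: step d)
  next
    case False
    then have "Suc j div p = j div p" by (simp add: div_Suc dvd_eq_mod_eq_0)
    then show ?thesis using Suc.IH not_dvd_imp_multiplicity_0[OF False] by (simp only: step)
  qed
qed

text \<open>By strong induction, the recursion bounds the multiplicity by twice
  \<open>j div p\<close>, which is at most \<open>j\<close> since \<open>p \<ge> 2\<close>.\<close>

lemma multiplicity_fact_le:
  fixes p :: nat
  assumes "prime p"
  shows "multiplicity p (fact j :: nat) \<le> j"
proof (induction j rule: less_induct)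
  case (less j)
  show ?case
  proof (cases "j = 0")
    case False
    have "2 \<le> p" using assms by (rule prime_ge_2_nat)
    then have "j div p < j" using False by simp
    then have "multiplicity p (fact (j div p) :: nat) \<le> j div p" by (rule less)
    moreover have "j div p + j div p \<le> j"
    proof -
      have "2 * (j div p) \<le> p * (j div p)" using \<open>2 \<le> p\<close> by (rule mult_right_mono) simp
      also have "\<dots> \<le> j" by simp
      finally show ?thesis by simp
    qed
    ultimately show ?thesis by (simp add: multiplicity_fact_rec[OF assms, of j])
  qed simp
qed

lemma prime_power_dvd_fact_div_mult_power:
  fixes p k n j :: nat and x :: int
  assumes "prime p" "p ^ k dvd (fact n :: nat)" "int p dvd x" "j \<le> n"
  shows "int (p ^ k) dvd (fact n div fact j) * x ^ j"
proof -
  define v where "v = multiplicity p (fact j :: nat)"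
  have "\<not> is_unit p" using assms(1) by (simp add: prime_nat_iff)
  then obtain m where m: "fact j = p ^ v * m" "\<not> p dvd m"
    using multiplicity_decompose'[of "fact j :: nat" p] unfolding v_def by auto
  define Y where "Y = (fact n div fact j) * x ^ j"
  have fn: "(fact n :: int) = fact j * (fact n div fact j)"
    using fact_dvd[OF assms(4), where 'a = int] by simp
  have "int (p ^ k) dvd fact n"
    using assms(2) by (metis int_dvd_int_iff of_nat_fact)
  moreover have "int p ^ v dvd x ^ j"
    using multiplicity_fact_le[OF assms(1), of j] assms(3) unfolding v_def
    by (meson dvd_power_same dvd_trans le_imp_power_dvd)
  \<comment> \<open>The \<open>v\<close> factors \<open>p\<close> lost on dividing by
    \<open>j!\<close> are regained from \<open>x ^ j\<close>. Cancelling \<open>p ^ v\<close> leaves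
    only the cofactor \<open>m\<close>, which is coprime to \<open>p\<close>.\<close>
  ultimately have "int (p ^ k) * int p ^ v dvd fact n * x ^ j"
    by (rule mult_dvd_mono)
  also have "fact n * x ^ j = int (fact j) * Y"
    unfolding Y_def using fn by (simp add: mult.assoc)
  also have "\<dots> = (int m * Y) * int p ^ v" using m(1) by simp
  finally have "int (p ^ k) dvd int m * Y"
    using assms(1) by (simp add: prime_gt_0_nat)
  moreover have "coprime (int (p ^ k)) (int m)"
    using m(2) assms(1) by (simp only: coprime_int_iff coprime_power_left_iff prime_imp_coprime_nat simp_thms)
  ultimately show ?thesis unfolding Y_def by (simp add: coprime_dvd_mult_right_iff)
qed

text \<open>The product of integer differences is a polynomial in \<open>n\<close> for fixed
  \<open>i\<close>, so it respects congruences, which the quotient of factorials does not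
  show.\<close>

lemma fact_div_fact_diff:
  assumes "i \<le> n"
  shows "(fact n div fact (n - i) :: int) = (\<Prod>l<i. int n - int l)"
proof -
  have "(fact n :: int) = fact (n - i) * (\<Prod>l<i. int n - int l)"
    using assms
  proof (induction i)
    case (Suc i)
    then have "n - i = Suc (n - Suc i)" by simp
    then have "(fact (n - i) :: int) = (int n - int i) * fact (n - Suc i)"
      using Suc.prems by (simp add: of_nat_diff)
    then show ?case using Suc by simp
  qed simp
  then show ?thesis by simp
qed

lemma schenker_sum_falling:
  "schenker_sum h n = (\<Sum>i\<le>n. (\<Prod>l<i. int n - int l) * poly h (int n) ^ (n - i))"
proof -
  have "schenker_sum h n = (\<Sum>i\<le>n. (fact n div fact (n - i)) * poly h (int n) ^ (n - i))"
    unfolding schenker_sum_def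
    by (rule sum.reindex_bij_witness[of _ "\<lambda>i. n - i" "\<lambda>i. n - i"]) auto
  then show ?thesis by (simp add: fact_div_fact_diff)
qed

text \<open>The cofactor is the binomial coefficient of \<open>n\<close> over
  \<open>i\<close>.\<close>

lemma fact_dvd_falling:
  assumes "i \<le> n"
  shows "(fact i :: int) dvd (\<Prod>l<i. int n - int l)"
proof -
  have "(fact i * fact (n - i) :: int) dvd fact n"
    using fact_fact_dvd_fact[of i "n - i", where 'a = int] assms by simp
  then obtain c where "fact n = fact i * fact (n - i) * (c :: int)" by (auto elim: dvdE)
  then have "(fact n div fact (n - i) :: int) = fact i * c" by simp
  then show ?thesis using fact_div_fact_diff[OF assms] by simp
qed

text \<open>The number of remaining summands no longer depends on \<open>n\<close>, so the sums for
  \<open>n\<close> and \<open>n + T\<close> can be compared term by term.\<close>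

lemma schenker_sum_cong_truncated:
  fixes q n0 n :: nat
  assumes "q dvd (fact n0 :: nat)" "n0 \<le> n"
  shows "[schenker_sum h n = (\<Sum>i<n0. (\<Prod>l<i. int n - int l) * poly h (int n) ^ (n - i))] (mod int q)"
proof -
  let ?f = "\<lambda>i. (\<Prod>l<i. int n - int l) * poly h (int n) ^ (n - i)"
  have "{..n} = {..<n0} \<union> {n0..n}" using assms(2) by auto
  then have eq: "schenker_sum h n = sum ?f {..<n0} + sum ?f {n0..n}"
    unfolding schenker_sum_falling by (simp add: sum.union_disjoint ivl_disj_int)
  have "int q dvd sum ?f {n0..n}"
  proof (rule dvd_sum)
    fix i assume i: "i \<in> {n0..n}"
    have "int q dvd fact n0" using assms(1) by (metis int_dvd_int_iff of_nat_fact)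
    also have "(fact n0 :: int) dvd fact i" using i by (intro fact_dvd) simp
    also have "\<dots> dvd (\<Prod>l<i. int n - int l)" using i by (intro fact_dvd_falling) simp
    finally show "int q dvd ?f i" by simp
  qed
  then show ?thesis unfolding eq by (simp add: cong_iff_dvd_diff)
qed

lemma poly_cong_int:
  fixes h :: "int poly" and a b m :: int
  assumes "[a = b] (mod m)"
  shows "[poly h a = poly h b] (mod m)"
  using assms by (induction h) (auto intro!: cong_add cong_mult)

lemma schenker_sum_cong_prime_power:
  fixes p k n0 n T :: nat
  assumes p: "prime p" and k: "0 < k" and dvd: "p ^ k dvd (fact n0 :: nat)" and n: "n0 \<le> n"
    and T: "p ^ k * (p - 1) dvd T"
  shows "[schenker_sum h (n + T) = schenker_sum h n] (mod int (p ^ k))"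
proof -
  let ?q = "int (p ^ k)"
  have qT: "p ^ k dvd T" using T by (rule dvd_mult_left)
  have shift: "[int (n + T) = int n] (mod ?q)"
    using qT by (simp only: cong_iff_dvd_diff of_nat_add add_diff_cancel_left' int_dvd_int_iff)
  have hq: "[poly h (int (n + T)) = poly h (int n)] (mod ?q)"
    by (rule poly_cong_int[OF shift])
  \<comment> \<open>Reducing further to modulus \<open>p\<close> shows that the case distinction
    below has the same outcome at \<open>n\<close> and at \<open>n + T\<close>.\<close>
  have "int p dvd ?q" using k by simp
  then have hp: "[poly h (int (n + T)) = poly h (int n)] (mod int p)"
    by (rule cong_dvd_modulus[OF hq])
  show ?thesis
  proof (cases "int p dvd poly h (int n)")
    case True
    have zero: "?q dvd schenker_sum h m" if "n0 \<le> m" "int p dvd poly h (int m)" for m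
    proof -
      have "p ^ k dvd (fact m :: nat)"
        using dvd fact_dvd[OF that(1), where 'a = nat] by (rule dvd_trans)
      then show ?thesis unfolding schenker_sum_def
        using p that by (intro dvd_sum prime_power_dvd_fact_div_mult_power) auto
    qed
    have "int p dvd poly h (int (n + T))" using True hp by (simp only: cong_dvd_iff)
    then have "?q dvd schenker_sum h (n + T)" using n by (intro zero) auto
    moreover have "?q dvd schenker_sum h n" using n True by (intro zero) auto
    ultimately show ?thesis by (simp only: cong_iff_dvd_diff dvd_diff)
  next
    case False
    let ?x = "poly h (int n)"
    have "coprime (int p) ?x"
      using False p by (intro prime_imp_coprime) simp_all
    then have "coprime ?x ?q" by (simp add: coprime_commute)
    moreover have "residues ?q"
      using one_less_power[OF prime_gt_1_nat[OF p] k] unfolding residues_def by linarith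
    ultimately have "[?x ^ totient (p ^ k) = 1] (mod ?q)"
      using residues.euler_theorem[of ?q ?x] by (simp only: nat_int)
    moreover have "totient (p ^ k) dvd T"
    proof -
      \<comment> \<open>The totient \<open>p ^ (k - 1) * (p - 1)\<close> divides
        \<open>p ^ k * (p - 1)\<close>; the full power \<open>p ^ k\<close> in \<open>T\<close>
        serves the congruence of \<open>n + T\<close> and \<open>n\<close>.\<close>
      have "p ^ (k - 1) dvd p ^ k" by (rule le_imp_power_dvd) simp
      then have "p ^ (k - 1) * (p - 1) dvd p ^ k * (p - 1)" by (rule mult_dvd_mono) simp
      then show ?thesis using T totient_prime_power[OF p k] by (metis dvd_trans)
    qed
    ultimately have xT: "[?x ^ T = 1] (mod ?q)"
      by (metis cong_pow dvdE power_mult power_one)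
    have "[(\<Sum>i<n0. (\<Prod>l<i. int (n + T) - int l) * poly h (int (n + T)) ^ (n + T - i)) =
           (\<Sum>i<n0. (\<Prod>l<i. int n - int l) * ?x ^ (n - i))] (mod ?q)"
    proof (intro cong_sum cong_mult cong_prod cong_diff shift cong_refl)
      fix i assume "i \<in> {..<n0}"
      \<comment> \<open>As \<open>i < n0 \<le> n\<close>, the subtraction on naturals is not
        truncated.\<close>
      then have "n + T - i = (n - i) + T" using n by simp
      then have "[poly h (int (n + T)) ^ (n + T - i) = ?x ^ (n - i) * ?x ^ T] (mod ?q)"
        using cong_pow[OF hq] by (simp only: power_add[symmetric])
      also have "[?x ^ (n - i) * ?x ^ T = ?x ^ (n - i) * 1] (mod ?q)"
        by (intro cong_mult cong_refl xT)
      finally show "[poly h (int (n + T)) ^ (n + T - i) = ?x ^ (n - i)] (mod ?q)" by simp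
    qed
    then show ?thesis
      using schenker_sum_cong_truncated[OF dvd n, of h]
        schenker_sum_cong_truncated[OF dvd trans_le_add1[OF n], of h T]
      by (meson cong_sym cong_trans)
  qed
qed

theorem corollary8:
  fixes h :: "int poly" and d s n0 :: nat and p k :: "nat \<Rightarrow> nat"
  assumes "\<And>i. i \<in> {1..s} \<Longrightarrow> prime (p i)"
    and "inj_on p {1..s}"
    and "\<And>i. i \<in> {1..s} \<Longrightarrow> 0 < k i"
    and "d = (\<Prod>i=1..s. p i ^ k i)"
    and "n0 = (LEAST n. 0 < n \<and> (\<forall>i\<in>{1..s}. p i ^ k i dvd (fact n :: nat)))"
  shows "periodic_from n0 (Lcm ((\<lambda>i. p i ^ k i * (p i - 1)) ` {1..s}))
           (\<lambda>n. schenker_sum h n mod int d)"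
proof -
  let ?T = "Lcm ((\<lambda>i. p i ^ k i * (p i - 1)) ` {1..s})"
  let ?P = "\<lambda>n. 0 < n \<and> (\<forall>i\<in>{1..s}. p i ^ k i dvd (fact n :: nat))"
  have d0: "0 < d" unfolding assms(4) using assms(1) by (intro prod_pos) (simp add: prime_gt_0_nat)
  \<comment> \<open>A witness is needed for \<open>LEAST\<close> to be meaningful: each prime power
    divides \<open>d\<close>, which divides \<open>d!\<close>.\<close>
  have "?P d"
  proof (intro conjI ballI d0)
    fix i assume "i \<in> {1..s}"
    then have "p i ^ k i dvd d" unfolding assms(4) by (intro dvd_prodI) auto
    also have "d dvd fact d" using d0 by (intro dvd_fact) auto
    finally show "p i ^ k i dvd fact d" .
  qed
  then have n0: "?P n0" unfolding assms(5) by (rule LeastI)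
  \<comment> \<open>The \<open>Lcm\<close> of a finite set vanishes only if the set contains
    0.\<close>
  have "0 \<notin> (\<lambda>i. p i ^ k i * (p i - 1)) ` {1..s}"
    using assms(1) by (fastforce dest: prime_gt_1_nat)
  then have "0 < ?T" by (subst neq0_conv[symmetric], subst Lcm_0_iff) simp_all
  moreover have "schenker_sum h (n + ?T) mod int d = schenker_sum h n mod int d" if "n0 \<le> n" for n
  proof -
    have "[schenker_sum h (n + ?T) = schenker_sum h n] (mod (\<Prod>i\<in>{1..s}. int (p i ^ k i)))"
    \<comment> \<open>The prime powers are pairwise coprime because \<open>p\<close> is injective,
      so the congruences combine to one modulo \<open>d\<close>.\<close>
    proof (rule cong_cong_prod_coprime; intro ballI impI)
      fix i assume "i \<in> {1..s}"
      then show "[schenker_sum h (n + ?T) = schenker_sum h n] (mod int (p i ^ k i))"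
        using assms(1,3) n0 that
        by (intro schenker_sum_cong_prime_power[where ?n0.0 = n0]) auto
    next
      fix i j assume "i \<in> {1..s}" "j \<in> {1..s}" "i \<noteq> j"
      then have "p i \<noteq> p j" using assms(2) by (auto dest: inj_onD)
      then have "coprime (p i) (p j)"
        using \<open>i \<in> {1..s}\<close> \<open>j \<in> {1..s}\<close> assms(1) by (intro primes_coprime) auto
      then show "coprime (int (p i ^ k i)) (int (p j ^ k j))" by simp
    qed
    then show ?thesis unfolding assms(4) by (simp add: cong_def)
  qed
  ultimately show ?thesis unfolding periodic_from_def by blast
qed

end
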